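(* Let $G$ be a finite group and $N\unlhd G$ a normal subgroup. Then: (1) $G$ is almost monomial if and only if $G$ is relative almost monomial with respect to the trivial subgroup $\{1\}\unlhd G$. (2) If $G$ is relative almost monomial with respect to $N$, then $G/N$ is almost monomial.
   Context: All characters are complex characters of finite groups, and $\operatorname{Irr}(G)$ is the set of irreducible characters of $G$. A linear character is a character of degree $1$. For $H\leqslant G$, $\chi_H$ denotes restriction to $H$ and $\theta^G$ denotes induction from $H$ to $G$. For a character $\chi$ of $G$, $\operatorname{Cons}(\chi):=\{\phi\in\operatorname{Irr}(G):\langle\phi,\chi\rangle>0\}$ is its set of constituents. A finite group $G$ is called almost monomial if for any $\chi\neq\phi\in\operatorname{Irr}(G)$ there exist a subgroup $H\leqslant G$ and a linear character $\lambda$ of $H$ such that $\chi\in\operatorname{Cons}(\lambda^G)$ and $\phi\notin\operatorname{Cons}(\lambda^G)$. Let $N\unlhd G$. The group $G$ is called relative almost monomial with respect to $N$ if for any $\chi\neq\phi\in\operatorname{Irr}(G)$ there exist a subgroup $H$ with $N\subseteq H\leqslant G$ and $\psi\in\operatorname{Irr}(H)$ such that $\psi_N\in\operatorname{Irr}(N)$, $\chi\in\operatorname{Cons}(\psi^G)$ and $\phi\notin\operatorname{Cons}(\psi^G)$. *)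

theory Defs
  imports
    "HOL-Algebra.Coset"
    "HOL-Library.Complex_Order"
    "Jordan_Normal_Form.VS_Connect"
begin

text \<open>Group homomorphisms from \<open>G\<close> into \<open>GL(n, C)\<close>, the latter being the group of units of the
  ring of complex \<open>n \<times> n\<close> matrices.\<close>

definition representation :: "('a, 'b) monoid_scheme \<Rightarrow> nat \<Rightarrow> ('a \<Rightarrow> complex mat) \<Rightarrow> bool"
  where "representation G n \<rho> \<longleftrightarrow> 0 < n \<and> \<rho> \<in> hom G (units_of (ring_mat TYPE(complex) n ()))"

definition irreducible_representation ::
    "('a, 'b) monoid_scheme \<Rightarrow> nat \<Rightarrow> ('a \<Rightarrow> complex mat) \<Rightarrow> bool"
  where "irreducible_representation G n \<rho> \<longleftrightarrow> representation G n \<rho> \<and>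
    (\<forall>W. VectorSpace.subspace class_ring W (module_vec TYPE(complex) n) \<and>
         (\<forall>g\<in>carrier G. \<forall>w\<in>W. \<rho> g *\<^sub>v w \<in> W)
       \<longrightarrow> W = {0\<^sub>v n} \<or> W = carrier_vec n)"

definition mat_trace :: "complex mat \<Rightarrow> complex"
  where "mat_trace A = (\<Sum>i<dim_row A. A $$ (i, i))"

text \<open>Characters are made extensional (\<open>undefined\<close> outside the carrier), so that equality of
  characters is equality of functions, and restriction of characters to a subgroup \<open>H\<close>
  is \<open>restrict \<chi> H\<close>.\<close>

definition character_of :: "('a, 'b) monoid_scheme \<Rightarrow> ('a \<Rightarrow> complex mat) \<Rightarrow> 'a \<Rightarrow> complex"
  where "character_of G \<rho> = (\<lambda>g\<in>carrier G. mat_trace (\<rho> g))"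

definition characters :: "('a, 'b) monoid_scheme \<Rightarrow> ('a \<Rightarrow> complex) set"
  where "characters G = {\<chi>. \<exists>n \<rho>. representation G n \<rho> \<and> \<chi> = character_of G \<rho>}"

definition Irr :: "('a, 'b) monoid_scheme \<Rightarrow> ('a \<Rightarrow> complex) set"
  where "Irr G = {\<chi>. \<exists>n \<rho>. irreducible_representation G n \<rho> \<and> \<chi> = character_of G \<rho>}"

text \<open>The degree of a character is its value at the identity.\<close>

definition linear_characters :: "('a, 'b) monoid_scheme \<Rightarrow> ('a \<Rightarrow> complex) set"
  where "linear_characters G = {\<mu> \<in> characters G. \<mu> \<one>\<^bsub>G\<^esub> = 1}"

definition char_inner ::
    "('a, 'b) monoid_scheme \<Rightarrow> ('a \<Rightarrow> complex) \<Rightarrow> ('a \<Rightarrow> complex) \<Rightarrow> complex"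
  where "char_inner G \<phi> \<chi> =
    (\<Sum>g\<in>carrier G. \<phi> g * cnj (\<chi> g)) / of_nat (card (carrier G))"

text \<open>For complex numbers, \<open>0 < z\<close> means that \<open>z\<close> is real and positive.\<close>

definition constituents :: "('a, 'b) monoid_scheme \<Rightarrow> ('a \<Rightarrow> complex) \<Rightarrow> ('a \<Rightarrow> complex) set"
  where "constituents G \<chi> = {\<phi> \<in> Irr G. 0 < char_inner G \<phi> \<chi>}"

definition induced ::
    "('a, 'b) monoid_scheme \<Rightarrow> 'a set \<Rightarrow> ('a \<Rightarrow> complex) \<Rightarrow> 'a \<Rightarrow> complex"
  where "induced G H \<theta> = (\<lambda>g\<in>carrier G.
    (\<Sum>x\<in>carrier G.
       let y = x \<otimes>\<^bsub>G\<^esub> g \<otimes>\<^bsub>G\<^esub> inv\<^bsub>G\<^esub> x in if y \<in> H then \<theta> y else 0) / of_nat (card H))"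

definition almost_monomial :: "('a, 'b) monoid_scheme \<Rightarrow> bool"
  where "almost_monomial G \<longleftrightarrow> group G \<and> finite (carrier G) \<and>
    (\<forall>\<chi>\<in>Irr G. \<forall>\<phi>\<in>Irr G. \<chi> \<noteq> \<phi> \<longrightarrow>
      (\<exists>H \<mu>. subgroup H G \<and> \<mu> \<in> linear_characters (G\<lparr>carrier := H\<rparr>) \<and>
        \<chi> \<in> constituents G (induced G H \<mu>) \<and> \<phi> \<notin> constituents G (induced G H \<mu>)))"

definition relative_almost_monomial :: "('a, 'b) monoid_scheme \<Rightarrow> 'a set \<Rightarrow> bool"
  where "relative_almost_monomial G N \<longleftrightarrow> group G \<and> finite (carrier G) \<and> N \<lhd> G \<and>
    (\<forall>\<chi>\<in>Irr G. \<forall>\<phi>\<in>Irr G. \<chi> \<noteq> \<phi> \<longrightarrow>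
      (\<exists>H \<psi>. subgroup H G \<and> N \<subseteq> H \<and> \<psi> \<in> Irr (G\<lparr>carrier := H\<rparr>) \<and>
        restrict \<psi> N \<in> Irr (G\<lparr>carrier := N\<rparr>) \<and>
        \<chi> \<in> constituents G (induced G H \<psi>) \<and> \<phi> \<notin> constituents G (induced G H \<psi>)))"

end

theory Submission
  imports Defs
begin

text \<open>
  Over the trivial subgroup the two notions ask for the same pairs \<open>(H, \<psi>)\<close>: the trivial group
  acts on every vector space by the identity, so each of its irreducible representations has
  degree 1. Hence an irreducible \<open>\<psi>\<close> restricts irreducibly to the trivial subgroup exactly if it
  is linear (\<open>restrict_trivial_Irr_iff\<close>), and every linear character is irreducible.

  For a quotient \<open>G/N\<close>, two distinct irreducible characters inflate to distinct irreducible
  characters of \<open>G\<close>, and the hypothesis separates these by some \<open>\<psi>\<^sup>G\<close> with \<open>\<psi>\<close> irreducible on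
  \<open>H \<supseteq> N\<close> and on \<open>N\<close>. The point is that such a \<open>\<psi>\<close> is already inflated from a linear
  character of \<open>H/N\<close> (\<open>quotient_linear_character\<close>). An inflated character \<open>\<chi>\<close> is constant on
  cosets of \<open>N\<close>, so \<open>\<langle>\<chi>, \<psi>\<^sup>G\<rangle>\<close> sees only the sums of \<open>\<psi>\<^sup>G\<close> over these cosets, and they all
  vanish if the sums of \<open>\<psi>\<close> over the cosets \<open>hN\<close> do. Thus \<open>\<Sum>m\<in>N. \<psi> (h m) \<noteq> 0\<close> for
  some \<open>h\<close>. If \<open>\<rho>\<close> affords \<open>\<psi>\<close>, this is the trace of \<open>\<rho>(h) (\<Sum>m\<in>N. \<rho>(m))\<close>; the sum over \<open>N\<close>
  is therefore not zero, and its columns are vectors fixed by \<open>N\<close>. The vectors fixed by the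
  normal subgroup \<open>N\<close> form an \<open>H\<close>-invariant subspace, which by irreducibility is everything
  (\<open>sum_character_normal_subgroup_kernel\<close>). So \<open>\<psi>\<close> is constant on \<open>N\<close>. The same argument, with
  \<open>N\<close> in place of \<open>H\<close>, shows that an irreducible representation of \<open>N\<close> with constant character is
  trivial and hence of degree 1, so that \<open>\<psi>\<close> is linear.

  Finally, induction and the inner product commute with inflation (\<open>induced_inflate\<close>,
  \<open>char_inner_inflate\<close>), so the linear character of \<open>H/N\<close> separates the two given characters
  of \<open>G/N\<close>.
\<close>

section \<open>Representations by matrices\<close>

lemma subspace_module_vec_iff:
  "VectorSpace.subspace class_ring W (module_vec TYPE(complex) n) \<longleftrightarrow>
    W \<subseteq> carrier_vec n \<and> 0\<^sub>v n \<in> W \<and> (\<forall>v\<in>W. \<forall>w\<in>W. v + w \<in> W) \<and> (\<forall>c. \<forall>v\<in>W. c \<cdot>\<^sub>v v \<in> W)"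
proof -
  have "vectorspace class_ring (module_vec TYPE(complex) n)"
    by (rule vec_vs)
  moreover from this have "module class_ring (module_vec TYPE(complex) n)"
    by (rule vectorspace.axioms(1))
  ultimately show ?thesis
    unfolding VectorSpace.subspace_def submodule_def by (auto simp: module_vec_simps)
qed

lemma representation_closed:
  assumes "representation G n \<rho>" "g \<in> carrier G"
  shows "\<rho> g \<in> carrier_mat n n"
  using assms
  by (auto simp: representation_def hom_def units_of_def Units_def ring_mat_simps Pi_iff)

lemma representation_mult:
  assumes "representation G n \<rho>" "g \<in> carrier G" "h \<in> carrier G"
  shows "\<rho> (g \<otimes>\<^bsub>G\<^esub> h) = \<rho> g * \<rho> h"
  using assms by (auto simp: representation_def hom_def units_of_def ring_mat_simps)

lemma representation_one:
  assumes "group G" "representation G n \<rho>"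
  shows "\<rho> \<one>\<^bsub>G\<^esub> = 1\<^sub>m n"
proof -
  interpret M: ring "ring_mat TYPE(complex) n ()" by (rule ring_mat)
  have "\<rho> \<one>\<^bsub>G\<^esub> = \<one>\<^bsub>units_of (ring_mat TYPE(complex) n ())\<^esub>"
    using assms M.units_group by (auto simp: representation_def intro: hom_one)
  then show ?thesis by (simp add: units_of_def ring_mat_simps)
qed

lemma representation_restrict_subgroup:
  assumes "representation (G\<lparr>carrier := H\<rparr>) n \<rho>" "K \<subseteq> H"
  shows "representation (G\<lparr>carrier := K\<rparr>) n \<rho>"
  using assms by (auto simp: representation_def hom_def Pi_iff)

lemma character_of_one:
  assumes "group G" "representation G n \<rho>"
  shows "character_of G \<rho> \<one>\<^bsub>G\<^esub> = of_nat n"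
  using assms by (simp add: character_of_def representation_one mat_trace_def
      group.is_monoid monoid.one_closed)

lemma irreducible_imp_representation:
  "irreducible_representation G n \<rho> \<Longrightarrow> representation G n \<rho>"
  by (simp add: irreducible_representation_def)

lemma Irr_subset_characters: "Irr G \<subseteq> characters G"
  by (auto simp: Irr_def characters_def irreducible_representation_def)

lemma representation_degree_one_irreducible:
  assumes "representation G 1 \<rho>"
  shows "irreducible_representation G 1 \<rho>"
  unfolding irreducible_representation_def
proof (intro conjI allI impI assms)
  fix W
  assume "VectorSpace.subspace class_ring W (module_vec TYPE(complex) 1) \<and>
    (\<forall>g\<in>carrier G. \<forall>w\<in>W. \<rho> g *\<^sub>v w \<in> W)"
  then have W: "W \<subseteq> carrier_vec 1" "0\<^sub>v 1 \<in> W" "\<And>c v. v \<in> W \<Longrightarrow> c \<cdot>\<^sub>v v \<in> W"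
    by (auto simp: subspace_module_vec_iff)
  show "W = {0\<^sub>v 1} \<or> W = carrier_vec 1"
  proof (cases "W \<subseteq> {0\<^sub>v 1}")
    case True
    then show ?thesis using W by auto
  next
    case False
    then obtain w where w: "w \<in> W" "w \<noteq> 0\<^sub>v 1" by auto
    with W have wc: "w \<in> carrier_vec 1" by auto
    with w have w0: "w $ 0 \<noteq> 0" by (auto simp: vec_eq_iff)
    have "v \<in> W" if v: "v \<in> carrier_vec 1" for v
    proof -
      have "v = (v $ 0 / w $ 0) \<cdot>\<^sub>v w"
        using v wc w0 by (auto simp: vec_eq_iff)
      then show ?thesis using W(3)[OF w(1)] by metis
    qed
    then show ?thesis using W by auto
  qed
qed

text \<open>A representation affording a character with value 1 at the identity has degree 1, and a
  one-dimensional space has no proper nonzero subspace.\<close>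

lemma linear_characters_eq:
  assumes "group G"
  shows "linear_characters G = {\<chi> \<in> Irr G. \<chi> \<one>\<^bsub>G\<^esub> = 1}"
proof (intro Set.set_eqI iffI)
  fix \<chi> assume "\<chi> \<in> linear_characters G"
  then obtain n \<rho> where \<rho>: "representation G n \<rho>" "\<chi> = character_of G \<rho>" "\<chi> \<one>\<^bsub>G\<^esub> = 1"
    by (auto simp: linear_characters_def characters_def)
  then have "n = 1" using character_of_one[OF assms] by simp
  then show "\<chi> \<in> {\<chi> \<in> Irr G. \<chi> \<one>\<^bsub>G\<^esub> = 1}"
    using \<rho> representation_degree_one_irreducible by (auto simp: Irr_def)
next
  fix \<chi> assume "\<chi> \<in> {\<chi> \<in> Irr G. \<chi> \<one>\<^bsub>G\<^esub> = 1}"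
  then show "\<chi> \<in> linear_characters G"
    using Irr_subset_characters by (auto simp: linear_characters_def)
qed

text \<open>If \<open>G\<close> acts by the identity then all subspaces are invariant, in particular the line spanned
  by the first unit vector, which is proper as soon as there is a second one.\<close>

lemma irreducible_trivial_action_degree:
  assumes irr: "irreducible_representation G n \<rho>"
    and triv: "\<And>g. g \<in> carrier G \<Longrightarrow> \<rho> g = 1\<^sub>m n"
  shows "n = 1"
proof (rule ccontr)
  assume "n \<noteq> 1"
  moreover have "0 < n" using irr by (simp add: irreducible_representation_def representation_def)
  ultimately have n: "2 \<le> n" by simp
  let ?W = "{v \<in> carrier_vec n. \<forall>i<n. i \<noteq> 0 \<longrightarrow> v $ i = (0 :: complex)}"
  have "VectorSpace.subspace class_ring ?W (module_vec TYPE(complex) n)"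
    unfolding subspace_module_vec_iff by auto
  moreover have "\<forall>g\<in>carrier G. \<forall>w\<in>?W. \<rho> g *\<^sub>v w \<in> ?W"
    using triv by auto
  ultimately have "?W = {0\<^sub>v n} \<or> ?W = carrier_vec n"
    using irr by (auto simp: irreducible_representation_def)
  moreover have "unit_vec n 0 \<in> ?W" "unit_vec n 0 \<noteq> (0\<^sub>v n :: complex vec)"
    using n by (auto simp: vec_eq_iff)
  moreover have "unit_vec n 1 \<in> carrier_vec n" "unit_vec n 1 \<notin> ?W"
    using n by (auto intro!: exI[of _ 1])
  ultimately show False by blast
qed

section \<open>Relative almost monomial groups over the trivial subgroup\<close>

lemma restrict_trivial_Irr_iff:
  assumes G: "group G" and H: "subgroup H G" and \<psi>: "\<psi> \<in> characters (G\<lparr>carrier := H\<rparr>)"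
  shows "restrict \<psi> {\<one>\<^bsub>G\<^esub>} \<in> Irr (G\<lparr>carrier := {\<one>\<^bsub>G\<^esub>}\<rparr>) \<longleftrightarrow> \<psi> \<one>\<^bsub>G\<^esub> = 1"
proof -
  let ?T = "G\<lparr>carrier := {\<one>\<^bsub>G\<^esub>}\<rparr>"
  have T: "group ?T"
    using group.triv_subgroup[OF G] G by (rule subgroup.subgroup_is_group)
  have GH: "group (G\<lparr>carrier := H\<rparr>)"
    using H G by (rule subgroup.subgroup_is_group)
  have one: "\<one>\<^bsub>G\<^esub> \<in> H" using H by (rule subgroup.one_closed)
  obtain n \<rho> where \<rho>: "representation (G\<lparr>carrier := H\<rparr>) n \<rho>"
    and eq: "\<psi> = character_of (G\<lparr>carrier := H\<rparr>) \<rho>"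
    using \<psi> by (auto simp: characters_def)
  have deg: "\<psi> \<one>\<^bsub>G\<^esub> = of_nat n"
    using character_of_one[OF GH \<rho>] eq by simp
  have \<rho>T: "representation ?T n \<rho>"
    using \<rho> one by (auto intro: representation_restrict_subgroup)
  have res: "restrict \<psi> {\<one>\<^bsub>G\<^esub>} = character_of ?T \<rho>"
    using one by (auto simp: eq character_of_def)
  show ?thesis
  proof
    assume "restrict \<psi> {\<one>\<^bsub>G\<^esub>} \<in> Irr ?T"
    then obtain m \<sigma> where \<sigma>: "irreducible_representation ?T m \<sigma>"
      and "restrict \<psi> {\<one>\<^bsub>G\<^esub>} = character_of ?T \<sigma>"
      by (auto simp: Irr_def)
    moreover have "m = 1"
      using irreducible_trivial_action_degree[OF \<sigma>]
        representation_one[OF T irreducible_imp_representation[OF \<sigma>]] by simp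
    ultimately show "\<psi> \<one>\<^bsub>G\<^esub> = 1"
      using character_of_one[OF T irreducible_imp_representation[OF \<sigma>]]
      by (metis monoid.simps(2) monoid.surjective of_nat_1 partial_object.update_convs(1)
          restrict_apply' singletonI)
  next
    assume "\<psi> \<one>\<^bsub>G\<^esub> = 1"
    then have "n = 1" using deg by simp
    then show "restrict \<psi> {\<one>\<^bsub>G\<^esub>} \<in> Irr ?T"
      using representation_degree_one_irreducible \<rho>T res by (auto simp: Irr_def)
  qed
qed

lemma almost_monomial_iff_relative_trivial:
  assumes "group G"
  shows "almost_monomial G \<longleftrightarrow> relative_almost_monomial G {\<one>\<^bsub>G\<^esub>}"
proof -
  have "(subgroup H G \<and> \<mu> \<in> linear_characters (G\<lparr>carrier := H\<rparr>) \<and> R) \<longleftrightarrow>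
      (subgroup H G \<and> {\<one>\<^bsub>G\<^esub>} \<subseteq> H \<and> \<mu> \<in> Irr (G\<lparr>carrier := H\<rparr>) \<and>
      restrict \<mu> {\<one>\<^bsub>G\<^esub>} \<in> Irr (G\<lparr>carrier := {\<one>\<^bsub>G\<^esub>}\<rparr>) \<and> R)" for H \<mu> R
  proof (cases "subgroup H G \<and> \<mu> \<in> Irr (G\<lparr>carrier := H\<rparr>)")
    case True
    then have H: "subgroup H G" and "\<mu> \<in> characters (G\<lparr>carrier := H\<rparr>)"
      using Irr_subset_characters by blast+
    from restrict_trivial_Irr_iff[OF assms this] True subgroup.one_closed[OF H] show ?thesis
      by (simp add: linear_characters_eq[OF subgroup.subgroup_is_group[OF H assms]])
  next
    case False
    then show ?thesis
      using linear_characters_eq[OF subgroup.subgroup_is_group[OF _ assms]] by blast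
  qed
  then show ?thesis
    unfolding almost_monomial_def relative_almost_monomial_def
    by (simp only: group.one_is_normal[OF assms] simp_thms)
qed

section \<open>Normal subgroups in the kernel of an irreducible representation\<close>

text \<open>With \<open>P = (\<Sum>m\<in>N. \<rho>(m))\<close>, the sum in the hypothesis is the trace of \<open>\<rho>(g) P\<close>, so \<open>P \<noteq> 0\<close>.
  Since \<open>\<rho>(m) P = P\<close> for \<open>m \<in> N\<close>, a nonzero column of \<open>P\<close> is a nonzero fixed vector of \<open>N\<close>; the
  fixed space of \<open>N\<close> is invariant under \<open>G\<close> because \<open>N\<close> is normal, so it is the whole space.\<close>

lemma sum_character_normal_subgroup_kernel:
  assumes G: "group G" and N: "N \<lhd> G"
    and irr: "irreducible_representation G n \<rho>"
    and g: "g \<in> carrier G" and nz: "(\<Sum>m\<in>N. character_of G \<rho> (g \<otimes>\<^bsub>G\<^esub> m)) \<noteq> 0"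
    and k: "k \<in> N"
  shows "\<rho> k = 1\<^sub>m n"
proof -
  interpret G: group G by fact
  interpret N: normal N G by fact
  note rep = irreducible_imp_representation[OF irr]
  note closed = representation_closed[OF rep]
  note mult = representation_mult[OF rep]
  define P where "P = mat n n (\<lambda>(i, j). \<Sum>m\<in>N. \<rho> m $$ (i, j))"
  define W where "W = {w \<in> carrier_vec n. \<forall>m\<in>N. \<rho> m *\<^sub>v w = w}"
  have P: "P \<in> carrier_mat n n" by (simp add: P_def)
  have mult_P: "\<rho> x * P = mat n n (\<lambda>(i, j). \<Sum>m\<in>N. \<rho> (x \<otimes>\<^bsub>G\<^esub> m) $$ (i, j))"
    if x: "x \<in> carrier G" for x
  proof (rule eq_matI)
    fix i j assume "i < dim_row (mat n n (\<lambda>(i, j). \<Sum>m\<in>N. \<rho> (x \<otimes>\<^bsub>G\<^esub> m) $$ (i, j)))"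
      "j < dim_col (mat n n (\<lambda>(i, j). \<Sum>m\<in>N. \<rho> (x \<otimes>\<^bsub>G\<^esub> m) $$ (i, j)))"
    then have ij: "i < n" "j < n" by auto
    have "(\<rho> x * P) $$ (i, j) = (\<Sum>l<n. \<Sum>m\<in>N. \<rho> x $$ (i, l) * \<rho> m $$ (l, j))"
      using ij closed[OF x] by (simp add: P_def scalar_prod_def sum_distrib_left atLeast0LessThan)
    also have "\<dots> = (\<Sum>m\<in>N. \<Sum>l<n. \<rho> x $$ (i, l) * \<rho> m $$ (l, j))"
      by (rule sum.swap)
    also have "\<dots> = (\<Sum>m\<in>N. \<rho> (x \<otimes>\<^bsub>G\<^esub> m) $$ (i, j))"
    proof (rule sum.cong[OF refl])
      fix m assume m: "m \<in> N"
      then show "(\<Sum>l<n. \<rho> x $$ (i, l) * \<rho> m $$ (l, j)) = \<rho> (x \<otimes>\<^bsub>G\<^esub> m) $$ (i, j)"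
        using ij closed[OF x] closed[of m] mult[OF x, of m]
        by (simp add: scalar_prod_def atLeast0LessThan)
    qed
    finally show "(\<rho> x * P) $$ (i, j) = mat n n (\<lambda>(i, j). \<Sum>m\<in>N. \<rho> (x \<otimes>\<^bsub>G\<^esub> m) $$ (i, j)) $$ (i, j)"
      using ij by simp
  qed (use closed[OF x] in \<open>auto simp: P_def\<close>)
  have absorb: "\<rho> m * P = P" if m: "m \<in> N" for m
  proof -
    have "(\<Sum>l\<in>N. \<rho> (m \<otimes>\<^bsub>G\<^esub> l) $$ ij) = (\<Sum>l\<in>N. \<rho> l $$ ij)" for ij
      by (rule sum.reindex_bij_witness[of _ "\<lambda>l. inv\<^bsub>G\<^esub> m \<otimes>\<^bsub>G\<^esub> l" "\<lambda>l. m \<otimes>\<^bsub>G\<^esub> l"])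
        (use m in \<open>auto simp: G.m_assoc[symmetric]\<close>)
    then show ?thesis using mult_P[of m] m by (simp add: P_def)
  qed
  have "P \<noteq> 0\<^sub>m n n"
  proof
    assume "P = 0\<^sub>m n n"
    then have "\<rho> g * P = 0\<^sub>m n n" using closed[OF g] by simp
    then have "(\<Sum>i<n. (\<rho> g * P) $$ (i, i)) = 0" by simp
    moreover have "(\<Sum>i<n. (\<rho> g * P) $$ (i, i)) = (\<Sum>m\<in>N. character_of G \<rho> (g \<otimes>\<^bsub>G\<^esub> m))"
    proof -
      have "(\<Sum>i<n. (\<rho> g * P) $$ (i, i)) = (\<Sum>i<n. \<Sum>m\<in>N. \<rho> (g \<otimes>\<^bsub>G\<^esub> m) $$ (i, i))"
        by (simp add: mult_P[OF g])
      also have "\<dots> = (\<Sum>m\<in>N. \<Sum>i<n. \<rho> (g \<otimes>\<^bsub>G\<^esub> m) $$ (i, i))"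
        by (rule sum.swap)
      also have "\<dots> = (\<Sum>m\<in>N. character_of G \<rho> (g \<otimes>\<^bsub>G\<^esub> m))"
      proof (rule sum.cong[OF refl])
        fix m assume "m \<in> N"
        then have "g \<otimes>\<^bsub>G\<^esub> m \<in> carrier G" using g by simp
        then show "(\<Sum>i<n. \<rho> (g \<otimes>\<^bsub>G\<^esub> m) $$ (i, i)) = character_of G \<rho> (g \<otimes>\<^bsub>G\<^esub> m)"
          using closed[of "g \<otimes>\<^bsub>G\<^esub> m"] by (auto simp: character_of_def mat_trace_def)
      qed
      finally show ?thesis .
    qed
    ultimately show False using nz by simp
  qed
  then obtain i j where ij: "i < n" "j < n" "P $$ (i, j) \<noteq> 0"
    using P by (auto simp: mat_eq_iff)
  have "col P j \<in> W"
  proof -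
    have "\<rho> m *\<^sub>v col P j = col P j" if m: "m \<in> N" for m
    proof -
      have "\<rho> m *\<^sub>v col P j = col (\<rho> m * P) j"
        using closed[of m] m P ij by (metis N.mem_carrier col_mult2)
      then show ?thesis using absorb[OF m] by simp
    qed
    then show ?thesis using P ij by (auto simp: W_def)
  qed
  moreover have "col P j \<noteq> 0\<^sub>v n"
    using ij P by (auto simp: vec_eq_iff)
  ultimately have "W \<noteq> {0\<^sub>v n}" by auto
  moreover have "W = {0\<^sub>v n} \<or> W = carrier_vec n"
  proof -
    have "VectorSpace.subspace class_ring W (module_vec TYPE(complex) n)"
      unfolding subspace_module_vec_iff
    proof (intro conjI ballI allI)
      have "\<rho> m *\<^sub>v 0\<^sub>v n = 0\<^sub>v n" if "m \<in> N" for m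
        using closed[of m] that by (intro eq_vecI) auto
      then show "0\<^sub>v n \<in> W" by (simp add: W_def)
      fix v w assume "v \<in> W" "w \<in> W"
      then show "v + w \<in> W"
        using closed by (auto simp: W_def mult_add_distrib_mat_vec[OF closed])
    next
      fix c v assume "v \<in> W"
      then show "c \<cdot>\<^sub>v v \<in> W"
        using closed by (auto simp: W_def mult_mat_vec[OF closed])
    qed (auto simp: W_def)
    moreover have "\<rho> x *\<^sub>v w \<in> W" if x: "x \<in> carrier G" and w: "w \<in> W" for x w
    proof -
      have wc: "w \<in> carrier_vec n" using w by (simp add: W_def)
      have "\<rho> m *\<^sub>v (\<rho> x *\<^sub>v w) = \<rho> x *\<^sub>v w" if m: "m \<in> N" for m
      proof -
        let ?m = "inv\<^bsub>G\<^esub> x \<otimes>\<^bsub>G\<^esub> m \<otimes>\<^bsub>G\<^esub> x"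
        have m': "?m \<in> N" using x m by (rule N.inv_op_closed1)
        have "m \<otimes>\<^bsub>G\<^esub> x = x \<otimes>\<^bsub>G\<^esub> ?m"
          using x m by (simp add: G.m_assoc[symmetric])
        then have "\<rho> m * \<rho> x = \<rho> x * \<rho> ?m"
          using mult x m m' by (metis N.mem_carrier)
        then have "\<rho> m *\<^sub>v (\<rho> x *\<^sub>v w) = \<rho> x *\<^sub>v (\<rho> ?m *\<^sub>v w)"
          using closed x m m' wc by (metis N.mem_carrier assoc_mult_mat_vec)
        then show ?thesis using w m' by (simp add: W_def)
      qed
      then show ?thesis using closed[OF x] wc by (auto simp: W_def)
    qed
    ultimately show ?thesis
      using irr unfolding irreducible_representation_def by blast
  qed
  ultimately have W: "W = carrier_vec n" by simp
  show ?thesis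
  proof (rule eq_matI)
    fix i j assume "i < dim_row (1\<^sub>m n :: complex mat)" "j < dim_col (1\<^sub>m n :: complex mat)"
    then have ij: "i < n" "j < n" by auto
    have kc: "\<rho> k \<in> carrier_mat n n" using closed k by simp
    have "unit_vec n j \<in> W" by (simp add: W)
    then have "\<rho> k *\<^sub>v unit_vec n j = unit_vec n j" using k by (simp add: W_def)
    then have "(\<rho> k *\<^sub>v unit_vec n j) $ i = unit_vec n j $ i" by simp
    then show "\<rho> k $$ (i, j) = 1\<^sub>m n $$ (i, j)" using kc ij by auto
  qed (use closed[of k] k in auto)
qed

text \<open>The constant value is the degree, so the sum of the character over the group is nonzero, and
  \<open>sum_character_normal_subgroup_kernel\<close> applies with \<open>N\<close> the whole group.\<close>

lemma irreducible_constant_character_degree: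
  assumes G: "group G" and fin: "finite (carrier G)"
    and irr: "irreducible_representation G n \<rho>"
    and const: "\<And>g. g \<in> carrier G \<Longrightarrow> character_of G \<rho> g = character_of G \<rho> \<one>\<^bsub>G\<^esub>"
  shows "n = 1"
proof -
  interpret G: group G by fact
  note rep = irreducible_imp_representation[OF irr]
  have "0 < n" using rep by (simp add: representation_def)
  moreover have "card (carrier G) \<noteq> 0" using fin G.one_closed by auto
  ultimately have "(\<Sum>m\<in>carrier G. character_of G \<rho> (\<one>\<^bsub>G\<^esub> \<otimes>\<^bsub>G\<^esub> m)) \<noteq> 0"
    using const character_of_one[OF G rep] by simp
  moreover have "carrier G \<lhd> G"
    by (simp add: G.normal_inv_iff G.subgroup_self)
  ultimately have "\<rho> k = 1\<^sub>m n" if "k \<in> carrier G" for k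
    using sum_character_normal_subgroup_kernel[OF G _ irr G.one_closed _ that] by blast
  then show ?thesis by (rule irreducible_trivial_action_degree[OF irr])
qed

section \<open>Inflation from a quotient\<close>

definition inflate ::
    "('a, 'b) monoid_scheme \<Rightarrow> 'a set \<Rightarrow> ('a set \<Rightarrow> complex) \<Rightarrow> 'a \<Rightarrow> complex"
  where "inflate G N f = (\<lambda>g\<in>carrier G. f (N #>\<^bsub>G\<^esub> g))"

lemma inflate_Irr:
  assumes N: "N \<lhd> G" and \<chi>: "\<chi> \<in> Irr (G Mod N)"
  shows "inflate G N \<chi> \<in> Irr G"
proof -
  interpret N: normal N G by fact
  obtain n \<rho> where irr: "irreducible_representation (G Mod N) n \<rho>"
    and eq: "\<chi> = character_of (G Mod N) \<rho>"
    using \<chi> by (auto simp: Irr_def)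
  let ?\<rho> = "\<rho> \<circ> (\<lambda>g. N #>\<^bsub>G\<^esub> g)"
  have "representation G n ?\<rho>"
    using irreducible_imp_representation[OF irr] hom_compose[OF N.r_coset_hom_Mod]
    by (auto simp: representation_def)
  moreover have "(\<forall>g\<in>carrier G. \<forall>w\<in>W. ?\<rho> g *\<^sub>v w \<in> W) \<longleftrightarrow>
      (\<forall>X\<in>carrier (G Mod N). \<forall>w\<in>W. \<rho> X *\<^sub>v w \<in> W)" for W
    by (simp add: carrier_FactGroup)
  ultimately have "irreducible_representation G n ?\<rho>"
    using irr by (simp add: irreducible_representation_def)
  moreover have "inflate G N \<chi> = character_of G ?\<rho>"
    by (auto simp: inflate_def eq character_of_def carrier_FactGroup)
  ultimately show ?thesis by (auto simp: Irr_def)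
qed

text \<open>Outside the carrier of the quotient both characters take the default value, so their values
  on cosets decide.\<close>

lemma inflate_inject:
  assumes "\<chi> \<in> Irr (G Mod N)" "\<phi> \<in> Irr (G Mod N)" "inflate G N \<chi> = inflate G N \<phi>"
  shows "\<chi> = \<phi>"
proof
  fix X
  show "\<chi> X = \<phi> X"
  proof (cases "X \<in> carrier (G Mod N)")
    case True
    then obtain g where "g \<in> carrier G" "X = N #>\<^bsub>G\<^esub> g" by (auto simp: carrier_FactGroup)
    then show ?thesis using fun_cong[OF assms(3), of g] by (simp add: inflate_def)
  next
    case False
    then show ?thesis using assms(1,2) by (auto simp: Irr_def character_of_def)
  qed
qed

text \<open>Each fibre of \<open>g \<mapsto> N g\<close> is a coset and has \<open>card N\<close> elements.\<close>

lemma sum_FactGroup: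
  fixes f :: "'a set \<Rightarrow> complex"
  assumes N: "N \<lhd> G" and fin: "finite (carrier G)"
  shows "(\<Sum>g\<in>carrier G. f (N #>\<^bsub>G\<^esub> g)) = of_nat (card N) * (\<Sum>X\<in>carrier (G Mod N). f X)"
proof -
  interpret N: normal N G by fact
  have fibre: "{g \<in> carrier G. N #>\<^bsub>G\<^esub> g = X} = X" if X: "X \<in> carrier (G Mod N)" for X
  proof -
    obtain a where a: "a \<in> carrier G" "X = N #>\<^bsub>G\<^esub> a" using X by (auto simp: carrier_FactGroup)
    have "g \<in> N #>\<^bsub>G\<^esub> a \<longleftrightarrow> g \<in> carrier G \<and> N #>\<^bsub>G\<^esub> g = N #>\<^bsub>G\<^esub> a" for g
      using a N.repr_independence[of g N a] N.rcos_self[of g] N.is_subgroup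
        N.r_coset_subset_G[OF N.subset a(1)] by auto
    then show ?thesis using a by blast
  qed
  have card: "card X = card N" if "X \<in> carrier (G Mod N)" for X
    using N.card_rcosets_equal[of X N] that N.subset by (simp add: FactGroup_def)
  have "(\<Sum>g\<in>carrier G. f (N #>\<^bsub>G\<^esub> g)) =
      (\<Sum>X\<in>carrier (G Mod N). \<Sum>g\<in>{g \<in> carrier G. N #>\<^bsub>G\<^esub> g = X}. f (N #>\<^bsub>G\<^esub> g))"
    unfolding carrier_FactGroup by (rule sum.image_gen[OF fin])
  also have "\<dots> = (\<Sum>X\<in>carrier (G Mod N). of_nat (card N) * f X)"
  proof (rule sum.cong[OF refl])
    fix X assume X: "X \<in> carrier (G Mod N)"
    have "(\<Sum>g\<in>{g \<in> carrier G. N #>\<^bsub>G\<^esub> g = X}. f (N #>\<^bsub>G\<^esub> g)) =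
        (\<Sum>g\<in>{g \<in> carrier G. N #>\<^bsub>G\<^esub> g = X}. f X)"
      by (rule sum.cong) auto
    then show "(\<Sum>g\<in>{g \<in> carrier G. N #>\<^bsub>G\<^esub> g = X}. f (N #>\<^bsub>G\<^esub> g)) = of_nat (card N) * f X"
      using fibre[OF X] card[OF X] by simp
  qed
  finally show ?thesis by (simp add: sum_distrib_left)
qed

lemma card_FactGroup:
  assumes "N \<lhd> G" "finite (carrier G)"
  shows "of_nat (card (carrier G)) = (of_nat (card N) * of_nat (card (carrier (G Mod N))) :: complex)"
  using sum_FactGroup[OF assms, of "\<lambda>_. 1"] by simp

lemma card_normal_nonzero:
  assumes "N \<lhd> G" "finite (carrier G)"
  shows "card N \<noteq> 0"
proof -
  interpret N: normal N G by fact
  have "finite N" by (rule finite_subset[OF N.subset assms(2)])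
  then show ?thesis using subgroup.one_closed[OF N.is_subgroup] card_0_eq by blast
qed

lemma char_inner_inflate:
  assumes "N \<lhd> G" "finite (carrier G)"
  shows "char_inner G (inflate G N \<chi>) (inflate G N \<theta>) = char_inner (G Mod N) \<chi> \<theta>"
proof -
  have "(\<Sum>g\<in>carrier G. inflate G N \<chi> g * cnj (inflate G N \<theta> g)) =
      (\<Sum>g\<in>carrier G. (\<lambda>X. \<chi> X * cnj (\<theta> X)) (N #>\<^bsub>G\<^esub> g))"
    by (rule sum.cong) (auto simp: inflate_def)
  also have "\<dots> = of_nat (card N) * (\<Sum>X\<in>carrier (G Mod N). \<chi> X * cnj (\<theta> X))"
    by (rule sum_FactGroup[OF assms])
  finally show ?thesis
    using card_normal_nonzero[OF assms] by (simp add: char_inner_def card_FactGroup[OF assms])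
qed

lemma inflate_constituents_iff:
  assumes "N \<lhd> G" "finite (carrier G)" "\<chi> \<in> Irr (G Mod N)"
  shows "inflate G N \<chi> \<in> constituents G (inflate G N \<theta>) \<longleftrightarrow> \<chi> \<in> constituents (G Mod N) \<theta>"
  using assms by (simp add: constituents_def inflate_Irr char_inner_inflate)

text \<open>The summand in the definition of \<open>induced\<close> depends on the summation variable only through its
  coset, so the sum over \<open>G\<close> is \<open>card N\<close> times the sum over \<open>G/N\<close>; this factor cancels against
  \<open>card H = card N * card (H/N)\<close>. Since \<open>N \<subseteq> H\<close>, membership in \<open>H\<close> is a
  property of cosets.\<close>

lemma induced_inflate:
  assumes N: "N \<lhd> G" and fin: "finite (carrier G)"
    and H: "subgroup H G" and NH: "N \<subseteq> H"
    and \<psi>: "\<And>h. h \<in> H \<Longrightarrow> \<psi> h = \<mu> (N #>\<^bsub>G\<^esub> h)"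
  shows "induced G H \<psi> = inflate G N (induced (G Mod N) (carrier (G\<lparr>carrier := H\<rparr> Mod N)) \<mu>)"
proof
  interpret N: normal N G by fact
  interpret H: subgroup H G by fact
  interpret Q: group "G Mod N" by (rule N.factorgroup_is_group)
  let ?GH = "G\<lparr>carrier := H\<rparr>"
  let ?Hq = "carrier (?GH Mod N)"
  have NGH: "N \<lhd> ?GH" by (rule N.normal_restrict_supergroup[OF H N NH])
  have finH: "finite (carrier ?GH)" using fin H.subset by (auto intro: finite_subset)
  have Hq: "?Hq = (\<lambda>x. N #>\<^bsub>G\<^esub> x) ` H" by (simp add: carrier_FactGroup)
  have mem: "N #>\<^bsub>G\<^esub> y \<in> ?Hq \<longleftrightarrow> y \<in> H" if y: "y \<in> carrier G" for y
  proof
    assume "N #>\<^bsub>G\<^esub> y \<in> ?Hq"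
    then obtain h where h: "h \<in> H" "N #>\<^bsub>G\<^esub> y = N #>\<^bsub>G\<^esub> h" by (auto simp: Hq)
    then have "y \<in> N #>\<^bsub>G\<^esub> h" using N.rcos_self[OF y N.is_subgroup] by simp
    then show "y \<in> H" using h NH by (auto simp: r_coset_def)
  qed (auto simp: Hq)
  fix g
  show "induced G H \<psi> g = inflate G N (induced (G Mod N) ?Hq \<mu>) g"
  proof (cases "g \<in> carrier G")
    case False
    then show ?thesis by (simp add: induced_def inflate_def)
  next
    case g: True
    let ?F = "\<lambda>X. let Y = X \<otimes>\<^bsub>G Mod N\<^esub> (N #>\<^bsub>G\<^esub> g) \<otimes>\<^bsub>G Mod N\<^esub> inv\<^bsub>G Mod N\<^esub> X
      in if Y \<in> ?Hq then \<mu> Y else 0"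
    have gq: "N #>\<^bsub>G\<^esub> g \<in> carrier (G Mod N)" using g by (simp add: carrier_FactGroup)
    have "(\<Sum>x\<in>carrier G. let y = x \<otimes>\<^bsub>G\<^esub> g \<otimes>\<^bsub>G\<^esub> inv\<^bsub>G\<^esub> x in if y \<in> H then \<psi> y else 0) =
        (\<Sum>x\<in>carrier G. ?F (N #>\<^bsub>G\<^esub> x))"
    proof (rule sum.cong[OF refl])
      fix x assume x: "x \<in> carrier G"
      have xq: "N #>\<^bsub>G\<^esub> x \<in> carrier (G Mod N)" using x by (simp add: carrier_FactGroup)
      have "(N #>\<^bsub>G\<^esub> x) \<otimes>\<^bsub>G Mod N\<^esub> (N #>\<^bsub>G\<^esub> g) \<otimes>\<^bsub>G Mod N\<^esub> inv\<^bsub>G Mod N\<^esub> (N #>\<^bsub>G\<^esub> x) =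
          N #>\<^bsub>G\<^esub> (x \<otimes>\<^bsub>G\<^esub> g \<otimes>\<^bsub>G\<^esub> inv\<^bsub>G\<^esub> x)"
        using x g xq by (simp add: N.inv_FactGroup N.rcos_inv N.rcos_sum)
      moreover have "x \<otimes>\<^bsub>G\<^esub> g \<otimes>\<^bsub>G\<^esub> inv\<^bsub>G\<^esub> x \<in> carrier G" using x g by simp
      ultimately show "(let y = x \<otimes>\<^bsub>G\<^esub> g \<otimes>\<^bsub>G\<^esub> inv\<^bsub>G\<^esub> x in if y \<in> H then \<psi> y else 0) =
          ?F (N #>\<^bsub>G\<^esub> x)"
        by (simp add: Let_def mem \<psi>)
    qed
    also have "\<dots> = of_nat (card N) * (\<Sum>X\<in>carrier (G Mod N). ?F X)"
      by (rule sum_FactGroup[OF N fin])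
    moreover have "of_nat (card H) = (of_nat (card N) * of_nat (card ?Hq) :: complex)"
      using card_FactGroup[OF NGH finH] by simp
    ultimately show ?thesis
      using g gq card_normal_nonzero[OF N fin] by (simp add: induced_def inflate_def)
  qed
qed

lemma representation_descends:
  assumes G: "group G" and N: "N \<lhd> G" and rep: "representation G n \<rho>"
    and triv: "\<And>m. m \<in> N \<Longrightarrow> \<rho> m = 1\<^sub>m n"
  obtains \<sigma> where "representation (G Mod N) n \<sigma>"
    "\<And>g. g \<in> carrier G \<Longrightarrow> \<sigma> (N #>\<^bsub>G\<^esub> g) = \<rho> g"
proof -
  interpret N: normal N G by fact
  have "\<rho> x = \<rho> y" if x: "x \<in> carrier G" and y: "y \<in> carrier G"
    and eq: "N #>\<^bsub>G\<^esub> x = N #>\<^bsub>G\<^esub> y" for x y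
  proof -
    have "x \<in> N #>\<^bsub>G\<^esub> y" using N.rcos_self[OF x N.is_subgroup] eq by simp
    then obtain m where m: "m \<in> N" "x = m \<otimes>\<^bsub>G\<^esub> y" by (auto simp: r_coset_def)
    then show ?thesis
      using representation_mult[OF rep _ y, of m] representation_closed[OF rep y] triv by simp
  qed
  then obtain \<sigma> where "\<sigma> \<in> hom (G Mod N) (units_of (ring_mat TYPE(complex) n ()))"
    "\<And>g. g \<in> carrier G \<Longrightarrow> \<sigma> (N #>\<^bsub>G\<^esub> g) = \<rho> g"
    using FactGroup_universal[OF _ N] rep unfolding representation_def by metis
  then show thesis using rep that by (simp add: representation_def)
qed

section \<open>Averages over cosets and induced characters\<close>

text \<open>Conjugation by \<open>x\<close> maps \<open>g N\<close> to the coset \<open>(x g x\<inverse>) N\<close>, which lies either inside \<open>H\<close>, where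
  the sum of \<open>\<psi>\<close> vanishes by hypothesis, or outside \<open>H\<close>, where it contributes nothing.\<close>

lemma sum_coset_induced_eq_0:
  assumes N: "N \<lhd> G" and H: "subgroup H G" and NH: "N \<subseteq> H"
    and \<psi>: "\<And>h. h \<in> H \<Longrightarrow> (\<Sum>m\<in>N. \<psi> (h \<otimes>\<^bsub>G\<^esub> m)) = 0"
    and g: "g \<in> carrier G"
  shows "(\<Sum>m\<in>N. induced G H \<psi> (g \<otimes>\<^bsub>G\<^esub> m)) = 0"
proof -
  interpret N: normal N G by fact
  interpret H: subgroup H G by fact
  let ?\<psi>0 = "\<lambda>y. if y \<in> H then \<psi> y else 0"
  have "(\<Sum>m\<in>N. ?\<psi>0 (x \<otimes>\<^bsub>G\<^esub> (g \<otimes>\<^bsub>G\<^esub> m) \<otimes>\<^bsub>G\<^esub> inv\<^bsub>G\<^esub> x)) = 0" if x: "x \<in> carrier G" for x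
  proof -
    let ?y = "x \<otimes>\<^bsub>G\<^esub> g \<otimes>\<^bsub>G\<^esub> inv\<^bsub>G\<^esub> x"
    have y: "?y \<in> carrier G" using x g by simp
    have "(\<Sum>m\<in>N. ?\<psi>0 (x \<otimes>\<^bsub>G\<^esub> (g \<otimes>\<^bsub>G\<^esub> m) \<otimes>\<^bsub>G\<^esub> inv\<^bsub>G\<^esub> x)) = (\<Sum>m\<in>N. ?\<psi>0 (?y \<otimes>\<^bsub>G\<^esub> m))"
    proof (rule sum.reindex_bij_witness[of _ "\<lambda>m. inv\<^bsub>G\<^esub> x \<otimes>\<^bsub>G\<^esub> m \<otimes>\<^bsub>G\<^esub> x"
          "\<lambda>m. x \<otimes>\<^bsub>G\<^esub> m \<otimes>\<^bsub>G\<^esub> inv\<^bsub>G\<^esub> x"])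
      fix m assume m: "m \<in> N"
      then have mc: "m \<in> carrier G" by simp
      show "x \<otimes>\<^bsub>G\<^esub> m \<otimes>\<^bsub>G\<^esub> inv\<^bsub>G\<^esub> x \<in> N" using x m by (rule N.inv_op_closed2)
      show "inv\<^bsub>G\<^esub> x \<otimes>\<^bsub>G\<^esub> m \<otimes>\<^bsub>G\<^esub> x \<in> N" using x m by (rule N.inv_op_closed1)
      show "inv\<^bsub>G\<^esub> x \<otimes>\<^bsub>G\<^esub> (x \<otimes>\<^bsub>G\<^esub> m \<otimes>\<^bsub>G\<^esub> inv\<^bsub>G\<^esub> x) \<otimes>\<^bsub>G\<^esub> x = m"
        using x mc by (simp add: N.m_assoc N.inv_solve_left')
      show "x \<otimes>\<^bsub>G\<^esub> (inv\<^bsub>G\<^esub> x \<otimes>\<^bsub>G\<^esub> m \<otimes>\<^bsub>G\<^esub> x) \<otimes>\<^bsub>G\<^esub> inv\<^bsub>G\<^esub> x = m"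
        using x mc N.m_assoc[symmetric, of x "inv\<^bsub>G\<^esub> x" m] by (simp add: N.m_assoc)
      have "?y \<otimes>\<^bsub>G\<^esub> (x \<otimes>\<^bsub>G\<^esub> m \<otimes>\<^bsub>G\<^esub> inv\<^bsub>G\<^esub> x) = x \<otimes>\<^bsub>G\<^esub> (g \<otimes>\<^bsub>G\<^esub> m) \<otimes>\<^bsub>G\<^esub> inv\<^bsub>G\<^esub> x"
        using x g mc N.m_assoc[symmetric, of "inv\<^bsub>G\<^esub> x" x] by (simp add: N.m_assoc)
      then show "?\<psi>0 (?y \<otimes>\<^bsub>G\<^esub> (x \<otimes>\<^bsub>G\<^esub> m \<otimes>\<^bsub>G\<^esub> inv\<^bsub>G\<^esub> x)) = ?\<psi>0 (x \<otimes>\<^bsub>G\<^esub> (g \<otimes>\<^bsub>G\<^esub> m) \<otimes>\<^bsub>G\<^esub> inv\<^bsub>G\<^esub> x)"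
        by simp
    qed
    also have "\<dots> = 0"
    proof (cases "?y \<in> H")
      case True
      then have "(\<Sum>m\<in>N. ?\<psi>0 (?y \<otimes>\<^bsub>G\<^esub> m)) = (\<Sum>m\<in>N. \<psi> (?y \<otimes>\<^bsub>G\<^esub> m))"
        using NH by (intro sum.cong) auto
      then show ?thesis using \<psi>[OF True] by simp
    next
      case False
      have "?y \<otimes>\<^bsub>G\<^esub> m \<notin> H" if m: "m \<in> N" for m
      proof
        assume "?y \<otimes>\<^bsub>G\<^esub> m \<in> H"
        then have "?y \<otimes>\<^bsub>G\<^esub> m \<otimes>\<^bsub>G\<^esub> inv\<^bsub>G\<^esub> m \<in> H" using m NH by auto
        then show False using False m y N.m_assoc[OF y, of m "inv\<^bsub>G\<^esub> m"] by simp
      qed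
      then show ?thesis by simp
    qed
    finally show ?thesis .
  qed
  then have "(\<Sum>x\<in>carrier G. \<Sum>m\<in>N. ?\<psi>0 (x \<otimes>\<^bsub>G\<^esub> (g \<otimes>\<^bsub>G\<^esub> m) \<otimes>\<^bsub>G\<^esub> inv\<^bsub>G\<^esub> x)) = 0"
    by simp
  then have "(\<Sum>m\<in>N. \<Sum>x\<in>carrier G. ?\<psi>0 (x \<otimes>\<^bsub>G\<^esub> (g \<otimes>\<^bsub>G\<^esub> m) \<otimes>\<^bsub>G\<^esub> inv\<^bsub>G\<^esub> x)) = 0"
    by (subst sum.swap)
  moreover have "(\<Sum>m\<in>N. induced G H \<psi> (g \<otimes>\<^bsub>G\<^esub> m)) =
      (\<Sum>m\<in>N. \<Sum>x\<in>carrier G. ?\<psi>0 (x \<otimes>\<^bsub>G\<^esub> (g \<otimes>\<^bsub>G\<^esub> m) \<otimes>\<^bsub>G\<^esub> inv\<^bsub>G\<^esub> x)) / of_nat (card H)"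
    using g by (simp add: induced_def Let_def sum_divide_distrib)
  ultimately show ?thesis by simp
qed

text \<open>Translating the summation variable by \<open>m \<in> N\<close> leaves the inflated factor unchanged. Averaging
  over all \<open>m\<close> replaces \<open>\<theta>\<close> by its coset sums.\<close>

lemma char_inner_inflate_eq_0:
  assumes N: "N \<lhd> G" and fin: "finite (carrier G)"
    and \<theta>: "\<And>g. g \<in> carrier G \<Longrightarrow> (\<Sum>m\<in>N. \<theta> (g \<otimes>\<^bsub>G\<^esub> m)) = 0"
  shows "char_inner G (inflate G N \<chi>) \<theta> = 0"
proof -
  interpret N: normal N G by fact
  let ?S = "\<Sum>g\<in>carrier G. inflate G N \<chi> g * cnj (\<theta> g)"
  have const: "inflate G N \<chi> (g \<otimes>\<^bsub>G\<^esub> m) = inflate G N \<chi> g" if "g \<in> carrier G" "m \<in> N" for g m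
  proof -
    have "N #>\<^bsub>G\<^esub> (g \<otimes>\<^bsub>G\<^esub> m) = (N #>\<^bsub>G\<^esub> g) <#>\<^bsub>G\<^esub> (N #>\<^bsub>G\<^esub> m)"
      using that by (simp add: N.rcos_sum)
    also have "\<dots> = (N #>\<^bsub>G\<^esub> g) <#>\<^bsub>G\<^esub> (N #>\<^bsub>G\<^esub> \<one>\<^bsub>G\<^esub>)"
      using that N.coset_join2[of m N] N.is_subgroup N.subset by simp
    also have "\<dots> = N #>\<^bsub>G\<^esub> g" using that by (simp only: N.rcos_sum N.one_closed N.r_one)
    finally show ?thesis using that by (simp add: inflate_def)
  qed
  have "?S = (\<Sum>g\<in>carrier G. inflate G N \<chi> g * cnj (\<theta> (g \<otimes>\<^bsub>G\<^esub> m)))" if m: "m \<in> N" for m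
  proof -
    have "?S = (\<Sum>g\<in>carrier G. inflate G N \<chi> (g \<otimes>\<^bsub>G\<^esub> m) * cnj (\<theta> (g \<otimes>\<^bsub>G\<^esub> m)))"
      by (rule sum.reindex_bij_witness[of _ "\<lambda>g. g \<otimes>\<^bsub>G\<^esub> m" "\<lambda>g. g \<otimes>\<^bsub>G\<^esub> inv\<^bsub>G\<^esub> m"])
        (use m in \<open>auto simp: N.m_assoc\<close>)
    then show ?thesis using const[OF _ m] by simp
  qed
  then have "(\<Sum>m\<in>N. ?S) = (\<Sum>m\<in>N. \<Sum>g\<in>carrier G. inflate G N \<chi> g * cnj (\<theta> (g \<otimes>\<^bsub>G\<^esub> m)))"
    by (rule sum.cong[OF refl])
  also have "\<dots> = (\<Sum>g\<in>carrier G. inflate G N \<chi> g * cnj (\<Sum>m\<in>N. \<theta> (g \<otimes>\<^bsub>G\<^esub> m)))"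
    by (subst sum.swap) (simp add: sum_distrib_left)
  also have "\<dots> = 0" using \<theta> by simp
  finally have "?S = 0" using card_normal_nonzero[OF N fin] by simp
  then show ?thesis by (simp add: char_inner_def)
qed

section \<open>Passing to the quotient\<close>

text \<open>An inflated function that is not orthogonal to \<open>\<psi>\<^sup>G\<close> forces \<open>N\<close> into the kernel of \<open>\<psi>\<close>;
  then \<open>\<psi>\<close> is constant on \<open>N\<close>, and being irreducible there it has degree 1.\<close>

lemma quotient_linear_character:
  assumes G: "group G" and fin: "finite (carrier G)" and N: "N \<lhd> G"
    and H: "subgroup H G" and NH: "N \<subseteq> H"
    and \<psi>: "\<psi> \<in> Irr (G\<lparr>carrier := H\<rparr>)" "restrict \<psi> N \<in> Irr (G\<lparr>carrier := N\<rparr>)"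
    and inner: "char_inner G (inflate G N \<chi>) (induced G H \<psi>) \<noteq> 0"
  obtains \<mu> where "\<mu> \<in> linear_characters (G\<lparr>carrier := H\<rparr> Mod N)"
    "\<And>h. h \<in> H \<Longrightarrow> \<psi> h = \<mu> (N #>\<^bsub>G\<^esub> h)"
proof -
  interpret G: group G by fact
  interpret N: normal N G by fact
  interpret H: subgroup H G by fact
  let ?GH = "G\<lparr>carrier := H\<rparr>" and ?GN = "G\<lparr>carrier := N\<rparr>"
  have GH: "group ?GH" by (rule H.subgroup_is_group[OF G])
  have GN: "group ?GN" by (rule N.subgroup_is_group[OF G])
  have NGH: "N \<lhd> ?GH" by (rule G.normal_restrict_supergroup[OF H N NH])
  have NGN: "finite (carrier ?GN)" using fin N.subset by (auto intro: finite_subset)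
  obtain n \<rho> where irr: "irreducible_representation ?GH n \<rho>" and \<psi>\<rho>: "\<psi> = character_of ?GH \<rho>"
    using \<psi>(1) by (auto simp: Irr_def)
  obtain k \<tau> where irr\<tau>: "irreducible_representation ?GN k \<tau>"
    and \<psi>\<tau>: "restrict \<psi> N = character_of ?GN \<tau>"
    using \<psi>(2) by (auto simp: Irr_def)
  note rep = irreducible_imp_representation[OF irr]
  \<comment> \<open>Otherwise all coset sums of the induced character vanish, and so does the inner product.\<close>
  obtain h where h: "h \<in> H" "(\<Sum>m\<in>N. \<psi> (h \<otimes>\<^bsub>G\<^esub> m)) \<noteq> 0"
    using inner sum_coset_induced_eq_0[OF N H NH, of \<psi>] char_inner_inflate_eq_0[OF N fin]
    by blast
  have triv: "\<rho> m = 1\<^sub>m n" if "m \<in> N" for m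
    using sum_character_normal_subgroup_kernel[OF GH NGH irr, of h m] h that by (simp add: \<psi>\<rho>)
  have const: "\<psi> m = of_nat n" if "m \<in> N" for m
    using that NH triv[OF that] by (auto simp: \<psi>\<rho> character_of_def mat_trace_def)
  have \<tau>_val: "character_of ?GN \<tau> m = of_nat n" if "m \<in> N" for m
    using const[OF that] that by (simp flip: \<psi>\<tau>)
  (* \<tau> and the restriction of \<rho> are only known to have the same character, so the degree is
     computed from \<tau>, which is the one known to be irreducible. *)
  have "k = 1"
    by (rule irreducible_constant_character_degree[OF GN NGN irr\<tau>]) (simp add: \<tau>_val)
  then have n: "n = 1"
    using character_of_one[OF GN irreducible_imp_representation[OF irr\<tau>]] \<tau>_val[of "\<one>\<^bsub>G\<^esub>"] by simp
  obtain \<sigma> where \<sigma>: "representation (?GH Mod N) n \<sigma>"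
    and \<sigma>_eq: "\<And>g. g \<in> H \<Longrightarrow> \<sigma> (N #>\<^bsub>G\<^esub> g) = \<rho> g"
    using representation_descends[OF GH NGH rep triv] by auto
  show thesis
  proof
    have "group (?GH Mod N)" by (rule normal.factorgroup_is_group[OF NGH])
    from character_of_one[OF this \<sigma>] n
    show "character_of (?GH Mod N) \<sigma> \<in> linear_characters (?GH Mod N)"
      using \<sigma> by (auto simp: linear_characters_def characters_def)
    show "\<psi> h = character_of (?GH Mod N) \<sigma> (N #>\<^bsub>G\<^esub> h)" if "h \<in> H" for h
      using that \<sigma>_eq by (auto simp: \<psi>\<rho> character_of_def carrier_FactGroup)
  qed
qed

lemma almost_monomial_FactGroup:
  assumes rel: "relative_almost_monomial G N"
  shows "almost_monomial (G Mod N)"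
proof -
  have G: "group G" and fin: "finite (carrier G)" and N: "N \<lhd> G"
    using rel by (auto simp: relative_almost_monomial_def)
  interpret N: normal N G by fact
  show ?thesis
    unfolding almost_monomial_def
  proof (intro conjI ballI impI)
    show "group (G Mod N)" by (rule N.factorgroup_is_group)
    show "finite (carrier (G Mod N))" using fin by (simp add: carrier_FactGroup)
    fix \<chi> \<phi> assume Irr: "\<chi> \<in> Irr (G Mod N)" "\<phi> \<in> Irr (G Mod N)" and "\<chi> \<noteq> \<phi>"
    then have "inflate G N \<chi> \<noteq> inflate G N \<phi>" using inflate_inject by blast
    then obtain H \<psi> where H: "subgroup H G" "N \<subseteq> H"
      and \<psi>: "\<psi> \<in> Irr (G\<lparr>carrier := H\<rparr>)" "restrict \<psi> N \<in> Irr (G\<lparr>carrier := N\<rparr>)"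
      and \<chi>: "inflate G N \<chi> \<in> constituents G (induced G H \<psi>)"
      and \<phi>: "inflate G N \<phi> \<notin> constituents G (induced G H \<psi>)"
      using rel Irr inflate_Irr[OF N] unfolding relative_almost_monomial_def by meson
    have "char_inner G (inflate G N \<chi>) (induced G H \<psi>) \<noteq> 0"
      using \<chi> by (auto simp: constituents_def)
    then obtain \<mu> where \<mu>: "\<mu> \<in> linear_characters (G\<lparr>carrier := H\<rparr> Mod N)"
      and \<psi>\<mu>: "\<And>h. h \<in> H \<Longrightarrow> \<psi> h = \<mu> (N #>\<^bsub>G\<^esub> h)"
      using quotient_linear_character[OF G fin N H \<psi>] by blast
    let ?Hq = "carrier (G\<lparr>carrier := H\<rparr> Mod N)"
    have "(G Mod N)\<lparr>carrier := ?Hq\<rparr> = G\<lparr>carrier := H\<rparr> Mod N"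
      by (simp add: FactGroup_def set_mult_def fun_eq_iff)
    then have "\<mu> \<in> linear_characters ((G Mod N)\<lparr>carrier := ?Hq\<rparr>)" using \<mu> by simp
    moreover have "subgroup ?Hq (G Mod N)"
    proof -
      interpret hom: group_hom G "G Mod N" "\<lambda>g. N #>\<^bsub>G\<^esub> g"
        by (rule group_hom.intro[OF G N.factorgroup_is_group])
          (simp add: group_hom_axioms_def N.r_coset_hom_Mod)
      show ?thesis using hom.subgroup_img_is_subgroup[OF H(1)] by (simp add: carrier_FactGroup)
    qed
    moreover have "induced G H \<psi> = inflate G N (induced (G Mod N) ?Hq \<mu>)"
      using N fin H \<psi>\<mu> by (rule induced_inflate)
    then have "\<chi> \<in> constituents (G Mod N) (induced (G Mod N) ?Hq \<mu>)"
      "\<phi> \<notin> constituents (G Mod N) (induced (G Mod N) ?Hq \<mu>)"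
      using \<chi> \<phi> Irr inflate_constituents_iff[OF N fin]
      by simp_all
    ultimately show "\<exists>H \<mu>. subgroup H (G Mod N) \<and>
        \<mu> \<in> linear_characters ((G Mod N)\<lparr>carrier := H\<rparr>) \<and>
        \<chi> \<in> constituents (G Mod N) (induced (G Mod N) H \<mu>) \<and>
        \<phi> \<notin> constituents (G Mod N) (induced (G Mod N) H \<mu>)"
      by blast
  qed
qed

theorem proposition4p2:
  fixes G :: "('a, 'b) monoid_scheme" and N :: "'a set"
  assumes "group G" and "finite (carrier G)" and "N \<lhd> G"
  shows "(almost_monomial G \<longleftrightarrow> relative_almost_monomial G {\<one>\<^bsub>G\<^esub>}) \<and>
    (relative_almost_monomial G N \<longrightarrow> almost_monomial (G Mod N))"
  using almost_monomial_iff_relative_trivial[OF assms(1)] almost_monomial_FactGroup by blast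

end
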